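(* For any $0<p\leq1$, there exists a non-normal meromorphic function $w$ in $\mathbb{D}$ such that its Schwarzian derivative $S_w$ is analytic in $\mathbb{D}$ and $|S_w(z)|^2(1-|z|^2)^{2+p}\,dm(z)$ is a $p$-Carleson measure.
   Context: $\mathbb{D}$ is the open unit disc of $\mathbb{C}$ and $dm(z)$ is the Lebesgue area measure on $\mathbb{D}$. A meromorphic function $w$ in $\mathbb{D}$ is normal if $\sup_{z\in\mathbb{D}}(1-|z|^2)\,w^{\#}(z)<\infty$, where $w^{\#}=|w'|/(1+|w|^2)$ is the spherical derivative of $w$; non-normal means not normal. The Schwarzian derivative of $w$ is $$S_w=\left(\frac{w''}{w'}\right)'-\frac12\left(\frac{w''}{w'}\right)^2.$$ For $0<p<\infty$, a positive Borel measure $\mu$ on $\mathbb{D}$ is a $p$-Carleson measure if $$\sup_{I\subset\partial\mathbb{D}}\frac{\mu(Q(I))}{|I|^p}<\infty,\qquad Q(I)=\{re^{i\theta}:1-|I|\leq r<1,\ e^{i\theta}\in I\},$$ where the supremum is over all subarcs $I\subset\partial\mathbb{D}$ and $|I|$ is the length of $I$ normalized so that $|\partial\mathbb{D}|=1$. *)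

theory Defs
  imports "HOL-Complex_Analysis.Complex_Analysis"
begin

text \<open>
  Meromorphic functions on the disc are \<^const>\<open>nicely_meromorphic_on\<close>: removable singularities
  are removed, and poles carry the dummy value 0.
\<close>

text \<open>At a pole the spherical derivative is understood as its continuous extension.\<close>

definition spherical_deriv :: "(complex \<Rightarrow> complex) \<Rightarrow> complex \<Rightarrow> real" where
  "spherical_deriv w z =
     (if is_pole w z
      then Lim (at z) (\<lambda>u. norm (deriv w u) / (1 + (norm (w u))\<^sup>2))
      else norm (deriv w z) / (1 + (norm (w z))\<^sup>2))"

definition normal_function :: "(complex \<Rightarrow> complex) \<Rightarrow> bool" where
  "normal_function w \<longleftrightarrow> w nicely_meromorphic_on ball 0 1 \<and>
     bdd_above ((\<lambda>z. (1 - (norm z)\<^sup>2) * spherical_deriv w z) ` ball 0 1)"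

text \<open>
  For meromorphic \<open>w\<close> the defining formula is again meromorphic, but at poles of \<open>w\<close> and zeros
  of \<open>w'\<close> it takes artefactual values (\<^const>\<open>deriv\<close> at a singularity, division by 0);
  \<^const>\<open>remove_sings\<close> replaces these by the limit where that exists, as it does at simple poles
  of \<open>w\<close>. At critical points and multiple poles of \<open>w\<close> the result still has a genuine pole,
  hence is not analytic there.
\<close>

definition schwarzian :: "(complex \<Rightarrow> complex) \<Rightarrow> complex \<Rightarrow> complex" where
  "schwarzian w = remove_sings (\<lambda>z.
     deriv (\<lambda>u. deriv (deriv w) u / deriv w u) z
       - 1 / 2 * (deriv (deriv w) z / deriv w z)\<^sup>2)"

text \<open>
  Nondegenerate arcs of the unit circle, with any subset of their endpoints; \<open>b = a + 2 * pi\<close>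
  gives the full circle and the punctured circles.
\<close>

definition subarcs :: "complex set set" where
  "subarcs = {I. \<exists>a b. a < b \<and> b \<le> a + 2 * pi \<and>
                 cis ` {a<..<b} \<subseteq> I \<and> I \<subseteq> cis ` {a..b}}"

definition arc_len :: "complex set \<Rightarrow> real" where
  "arc_len I = measure lborel {t \<in> {0..<2 * pi}. cis t \<in> I} / (2 * pi)"

definition carleson_square :: "complex set \<Rightarrow> complex set" where
  "carleson_square I =
     {of_real r * cis \<theta> | r \<theta>. 1 - arc_len I \<le> r \<and> r < 1 \<and> cis \<theta> \<in> I}"

definition carleson_measure :: "real \<Rightarrow> complex measure \<Rightarrow> bool" where
  "carleson_measure p \<mu> \<longleftrightarrow>
     sets \<mu> = sets (restrict_space borel (ball 0 1)) \<and>
     (SUP I\<in>subarcs. emeasure \<mu> (carleson_square I) / ennreal (arc_len I powr p)) < \<infinity>"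

end

theory Submission
  imports Defs
begin

text \<open>
  Put \<open>s = Ln (1 - z)\<close>, which maps the disc into the strip \<open>\<bar>Im s\<bar> < pi / 2\<close>, and let
  \<open>w = exp (- a s) (exp (\<i> s) - 1)\<close> with a small \<open>a > 0\<close>. At the zeros \<open>s = - 2 pi n\<close> of \<open>w\<close>
  the derivative with respect to \<open>s\<close> grows like \<open>exp (2 pi n a)\<close>, so \<open>w\<close> is not normal. On the
  other hand, up to the factor \<open>exp (- a s)\<close> this derivative is \<open>(\<i> - a) exp (\<i> s) + a\<close>, which is
  bounded away from zero on the strip; hence \<open>w\<close> is locally univalent and its Schwarzian derivative
  is \<open>O(1 / \<bar>1 - z\<bar>\<^sup>2)\<close>. The density of the measure is then \<open>O(\<bar>1 - z\<bar> powr (p - 2))\<close>, whose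
  integral over any square of side \<open>L\<close> is \<open>O(L powr p)\<close>.
\<close>

section \<open>A non-normal function with controlled Schwarzian derivative\<close>

text \<open>
  On the strip \<open>\<bar>exp (\<i> s)\<bar> > exp (- 2)\<close>, so half of this is admissible for \<open>a\<close>.
\<close>

definition growth_rate :: real where
  "growth_rate = exp (- 2) / 2"

definition spiral :: "complex \<Rightarrow> complex" where
  "spiral z = exp (- growth_rate * Ln (1 - z)) * (exp (\<i> * Ln (1 - z)) - 1)"

definition spiral_factor :: "complex \<Rightarrow> complex" where
  "spiral_factor z = (\<i> - growth_rate) * exp (\<i> * Ln (1 - z)) + growth_rate"

definition spiral_deriv :: "complex \<Rightarrow> complex" where
  "spiral_deriv z = - (exp (- growth_rate * Ln (1 - z)) * spiral_factor z / (1 - z))"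

text \<open>The quotient w''/w' for w = \<open>spiral\<close>, that is, the logarithmic derivative
  of \<open>spiral_deriv\<close>. With K = \<open>spiral_factor z\<close> and a =
  \<open>growth_rate\<close>, it comes from K' = - i (K - a) / (1 - z), so that z enters the
  numerator only through a / K.\<close>

definition spiral_log_deriv :: "complex \<Rightarrow> complex" where
  "spiral_log_deriv z =
     (1 + growth_rate - \<i> + \<i> * growth_rate / spiral_factor z) / (1 - z)"

text \<open>The first quotient is the derivative of \<open>spiral_log_deriv\<close>; its term with
  the square of \<open>spiral_factor z\<close> comes from differentiating a / K, the sign from i^2 =
  -1.\<close>

definition spiral_schwarzian :: "complex \<Rightarrow> complex" where
  "spiral_schwarzian z =
     (1 + growth_rate - \<i> + \<i> * growth_rate / spiral_factor z
        - growth_rate * (spiral_factor z - growth_rate) / (spiral_factor z)\<^sup>2) / (1 - z)\<^sup>2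
     - 1 / 2 * (spiral_log_deriv z)\<^sup>2"

section \<open>Non-vanishing on the disc\<close>

lemma growth_rate_pos: "growth_rate > 0"
  by (simp add: growth_rate_def)

lemma growth_rate_less_1: "growth_rate < 1"
proof -
  have "exp (- 2 :: real) < 1" by simp
  then show ?thesis
    unfolding growth_rate_def by linarith
qed

lemma Re_one_minus_pos:
  assumes "z \<in> ball 0 1"
  shows "Re (1 - z) > 0"
proof -
  have "Re z \<le> norm z" by (rule complex_Re_le_cmod)
  with assms show ?thesis by (simp add: dist_norm)
qed

lemma one_minus_neq_0:
  fixes z :: complex
  assumes "z \<in> ball 0 1"
  shows "1 - z \<noteq> 0"
  using Re_one_minus_pos[OF assms] by auto

text \<open>Since Im (Ln (1 - z)) < pi / 2 < 2, the exponential has modulus at least exp (-2) = 2 a,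
  and its coefficient i - a has modulus at least its imaginary part 1. Removing the summand a leaves
  a.\<close>

lemma spiral_factor_lower_bound:
  assumes "z \<in> ball 0 1"
  shows "norm (spiral_factor z) \<ge> growth_rate"
proof -
  let ?s = "Ln (1 - z)"
  have "Im ?s < 2"
    using Re_Ln_pos_lt_imp[OF Re_one_minus_pos[OF assms]] pi_less_4 by linarith
  then have "exp (- 2) \<le> norm (exp (\<i> * ?s))"
    by simp
  moreover have "1 \<le> norm (\<i> - complex_of_real growth_rate)"
    using abs_Im_le_cmod[of "\<i> - complex_of_real growth_rate"] by simp
  ultimately have "1 * exp (- 2) \<le> norm ((\<i> - complex_of_real growth_rate) * exp (\<i> * ?s))"
    unfolding norm_mult by (intro mult_mono) auto
  also have "\<dots> \<le> norm (spiral_factor z) + norm (complex_of_real growth_rate)"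
    unfolding spiral_factor_def by (metis add_diff_cancel_right' norm_triangle_ineq4)
  finally show ?thesis
    using growth_rate_pos by (simp add: growth_rate_def)
qed

lemma spiral_factor_neq_0:
  assumes "z \<in> ball 0 1"
  shows "spiral_factor z \<noteq> 0"
  using spiral_factor_lower_bound[OF assms] growth_rate_pos by auto

section \<open>Closed forms of the derivatives\<close>

lemma Ln_one_minus_has_field_derivative:
  assumes "z \<in> ball 0 1"
  shows "((\<lambda>z. Ln (1 - z)) has_field_derivative - (1 / (1 - z))) (at z)"
proof -
  have "1 - z \<notin> \<real>\<^sub>\<le>\<^sub>0"
    using Re_one_minus_pos[OF assms] by (auto simp: complex_nonpos_Reals_iff)
  then show ?thesis
    by (auto intro!: derivative_eq_intros simp: field_simps)
qed

lemma spiral_has_field_derivative: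
  assumes "z \<in> ball 0 1"
  shows "(spiral has_field_derivative spiral_deriv z) (at z)"
  unfolding spiral_def [abs_def]
  apply (rule DERIV_cong)
   apply (rule Ln_one_minus_has_field_derivative assms derivative_intros)+
  apply (simp add: spiral_deriv_def spiral_factor_def divide_inverse algebra_simps)
  done

lemma spiral_factor_has_field_derivative:
  assumes "z \<in> ball 0 1"
  shows "(spiral_factor has_field_derivative
           - (\<i> * (spiral_factor z - growth_rate) / (1 - z))) (at z)"
  unfolding spiral_factor_def [abs_def]
  apply (rule DERIV_cong)
   apply (rule Ln_one_minus_has_field_derivative assms derivative_intros)+
  apply (simp add: divide_inverse algebra_simps)
  done

lemma spiral_deriv_has_field_derivative:
  assumes "z \<in> ball 0 1"
  shows "(spiral_deriv has_field_derivative spiral_deriv z * spiral_log_deriv z) (at z)"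
proof -
  \<comment> \<open>The left side copies the term produced by the derivative rules, with E the
    exponential, L the logarithm, K the factor, k and r the inverses of K and 1 - z, and j the
    imaginary unit. What remains is a polynomial identity modulo K k = 1.\<close>
  have alg: "- ((E * (0 * L + - (1 * r) * - a) * K + - (j * (K - a) * r) * E) * r
        + - (r * (0 - 1) * r) * (E * K)) = - (E * K * r) * ((1 + a - j + j * a * k) * r)"
    if "K * k = 1" for E L r a K j k :: complex
    using that by algebra
  have "spiral_factor z * inverse (spiral_factor z) = 1"
    using spiral_factor_neq_0[OF assms] by simp
  from alg[OF this] show ?thesis
    unfolding spiral_deriv_def [abs_def] spiral_log_deriv_def divide_inverse
    apply -
    apply (rule DERIV_cong)
     apply (rule Ln_one_minus_has_field_derivative spiral_factor_has_field_derivative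
        DERIV_inverse' one_minus_neq_0 assms derivative_intros)+
    apply (simp only: divide_inverse of_real_minus of_real_add of_real_1)
    done
qed

lemma spiral_log_deriv_has_field_derivative:
  assumes "z \<in> ball 0 1"
  shows "(spiral_log_deriv has_field_derivative
           spiral_schwarzian z + 1 / 2 * (spiral_log_deriv z)\<^sup>2) (at z)"
proof -
  \<comment> \<open>Again the raw output of the derivative rules, with c the numerator of
    \<open>spiral_log_deriv\<close>. The relation j^2 = -1 merges the factor i in the derivative of
    K with the one in the coefficient i a.\<close>
  have alg: "(0 + (0 * k + - (k * - (j * (K - a) * r) * k) * (j * a))) * r
      + - (r * (0 - 1) * r) * c = (c - a * (K - a) * (k * k)) * (r * r)"
    if "j * j = - 1" for c r a K j k :: complex
    using that by algebra
  show ?thesis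
    unfolding spiral_log_deriv_def [abs_def] spiral_schwarzian_def divide_inverse
    apply (rule DERIV_cong)
     apply (rule spiral_factor_has_field_derivative DERIV_inverse' one_minus_neq_0
        spiral_factor_neq_0 assms derivative_intros)+
    apply (simp only: divide_inverse power2_eq_square inverse_mult_distrib diff_add_cancel)
    apply (rule alg[OF i_squared])
    done
qed

lemma analytic_on_ballI:
  assumes "\<And>z. z \<in> ball 0 1 \<Longrightarrow> (f has_field_derivative f' z) (at z)"
  shows "f analytic_on ball 0 1"
  using assms unfolding analytic_on_open[OF open_ball] holomorphic_on_open[OF open_ball] by blast

lemma spiral_analytic: "spiral analytic_on ball 0 1"
  by (rule analytic_on_ballI[OF spiral_has_field_derivative])

lemma spiral_schwarzian_analytic: "spiral_schwarzian analytic_on ball 0 1"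
proof -
  note [analytic_intros] = analytic_on_ballI[OF spiral_factor_has_field_derivative]
    analytic_on_ballI[OF spiral_log_deriv_has_field_derivative]
  show ?thesis
    unfolding spiral_schwarzian_def [abs_def]
    by (intro analytic_intros)
      (simp_all only: spiral_factor_neq_0 one_minus_neq_0 power_not_zero not_False_eq_True)
qed

section \<open>Identification and size of the Schwarzian derivative\<close>

lemma deriv_spiral:
  assumes "z \<in> ball 0 1"
  shows "deriv spiral z = spiral_deriv z"
  using spiral_has_field_derivative[OF assms] by (rule DERIV_imp_deriv)

lemma deriv_deriv_spiral:
  assumes "z \<in> ball 0 1"
  shows "deriv (deriv spiral) z = spiral_deriv z * spiral_log_deriv z"
proof -
  have "\<forall>\<^sub>F u in nhds z. deriv spiral u = spiral_deriv u"
    using eventually_nhds_in_open[OF open_ball assms] by eventually_elim (rule deriv_spiral)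
  then have "deriv (deriv spiral) z = deriv spiral_deriv z"
    by (rule deriv_cong_ev) simp
  with spiral_deriv_has_field_derivative[OF assms] show ?thesis
    by (simp add: DERIV_imp_deriv)
qed

lemma deriv_deriv_spiral_over_deriv:
  assumes "z \<in> ball 0 1"
  shows "deriv (deriv spiral) z / deriv spiral z = spiral_log_deriv z"
proof -
  have "spiral_deriv z \<noteq> 0"
    using assms one_minus_neq_0 spiral_factor_neq_0 by (simp add: spiral_deriv_def)
  with assms show ?thesis
    by (simp add: deriv_spiral deriv_deriv_spiral)
qed

text \<open>\<open>remove_sings\<close> keeps the value at a point of analyticity, and the raw
  formula is analytic because it agrees with \<open>spiral_schwarzian\<close> on the whole
  disc.\<close>

lemma schwarzian_spiral:
  assumes "z \<in> ball 0 1"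
  shows "schwarzian spiral z = spiral_schwarzian z"
proof -
  let ?f = "\<lambda>z. deriv (\<lambda>u. deriv (deriv spiral) u / deriv spiral u) z
       - 1 / 2 * (deriv (deriv spiral) z / deriv spiral z)\<^sup>2"
  have eq: "?f u = spiral_schwarzian u" if "u \<in> ball 0 1" for u
  proof -
    have "\<forall>\<^sub>F v in nhds u. deriv (deriv spiral) v / deriv spiral v = spiral_log_deriv v"
      using eventually_nhds_in_open[OF open_ball that]
      by eventually_elim (rule deriv_deriv_spiral_over_deriv)
    then have "deriv (\<lambda>u. deriv (deriv spiral) u / deriv spiral u) u = deriv spiral_log_deriv u"
      by (rule deriv_cong_ev) simp
    with spiral_log_deriv_has_field_derivative[OF that] deriv_deriv_spiral_over_deriv[OF that]
    show ?thesis
      by (simp add: DERIV_imp_deriv)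
  qed
  have "\<forall>\<^sub>F u in nhds z. ?f u = spiral_schwarzian u"
    using eventually_nhds_in_open[OF open_ball assms] by eventually_elim (rule eq)
  then have "?f analytic_on {z} \<longleftrightarrow> spiral_schwarzian analytic_on {z}"
    by (rule analytic_at_cong) simp
  with spiral_schwarzian_analytic assms have "?f analytic_on {z}"
    using analytic_on_analytic_at by blast
  then show ?thesis
    unfolding schwarzian_def using eq[OF assms] by simp
qed

lemma schwarzian_spiral_analytic: "schwarzian spiral analytic_on ball 0 1"
  using spiral_schwarzian_analytic schwarzian_spiral
  unfolding analytic_on_open[OF open_ball] by (metis holomorphic_transform)

text \<open>With q = a / K, of modulus at most 1 by the lower bound for K, the factor beside 1 / (1
  - z)^2 is A - q (1 - q) - A^2 / 2, where A is the numerator of \<open>spiral_log_deriv\<close>.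
  From |A| \<le> 4 comes 14 = 4 + 2 + 4^2 / 2.\<close>

lemma spiral_schwarzian_bound:
  assumes "z \<in> ball 0 1"
  shows "norm (spiral_schwarzian z) \<le> 14 / (norm (1 - z))\<^sup>2"
proof -
  let ?a = "complex_of_real growth_rate"
  define q where "q = ?a / spiral_factor z"
  have q: "norm q \<le> 1"
    using spiral_factor_lower_bound[OF assms] spiral_factor_neq_0[OF assms] growth_rate_pos
    by (simp add: q_def norm_divide divide_le_eq)
  define A where "A = 1 + ?a - \<i> + \<i> * q"
  have A: "norm A \<le> 4"
  proof -
    have "norm A \<le> norm (1 :: complex) + norm ?a + norm \<i> + norm (\<i> * q)"
      unfolding A_def
      by (meson add_mono norm_triangle_ineq norm_triangle_ineq4 order_refl order_trans)
    with q growth_rate_pos growth_rate_less_1 show ?thesis by (simp add: norm_mult)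
  qed
  have B: "norm (q * (1 - q)) \<le> 2"
  proof -
    have "norm (q * (1 - q)) \<le> 1 * 2"
      unfolding norm_mult using q norm_triangle_ineq4[of 1 q] by (intro mult_mono) auto
    then show ?thesis by simp
  qed
  have "spiral_schwarzian z = (A - q * (1 - q) - 1 / 2 * A\<^sup>2) / (1 - z)\<^sup>2"
    using spiral_factor_neq_0[OF assms]
    unfolding spiral_schwarzian_def spiral_log_deriv_def A_def q_def
    by (simp add: diff_divide_distrib right_diff_distrib left_diff_distrib power2_eq_square)
  moreover have "norm (A - q * (1 - q) - 1 / 2 * A\<^sup>2) \<le> 4 + 2 + 1 / 2 * 4\<^sup>2"
  proof -
    have "norm (1 / 2 * A\<^sup>2) \<le> 1 / 2 * 4\<^sup>2"
      using A power_mono[OF A, of 2] by (simp add: norm_mult norm_power norm_divide)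
    with A B show ?thesis
      by (smt (verit) norm_triangle_ineq4)
  qed
  ultimately show ?thesis
    by (simp add: norm_divide norm_power divide_right_mono)
qed

section \<open>Failure of normality\<close>

lemma spiral_not_normal: "\<not> normal_function spiral"
proof
  assume "normal_function spiral"
  then obtain M where M: "(1 - (norm z)\<^sup>2) * spherical_deriv spiral z \<le> M"
    if "z \<in> ball 0 1" for z
    unfolding normal_function_def bdd_above_def by (metis imageI)
  \<comment> \<open>At z = 1 - exp (- t) with t = 2 pi n the function vanishes, so its spherical
    derivative is |w'| = exp (a t) / exp (- t). The weight 1 - |z|^2 is at least exp (- t), which
    cancels the denominator and leaves exp (a t).\<close>
  have unbounded: "exp (growth_rate * (2 * pi * real n)) \<le> M" if "n > 0" for n
  proof -
    define t where "t = 2 * pi * real n"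
    have t: "t > 0" using that by (simp add: t_def)
    define z where "z = complex_of_real (1 - exp (- t))"
    have exp_t: "0 < exp (- t)" "exp (- t) < 1" using t by auto
    then have z: "z \<in> ball 0 1" by (simp add: z_def del: of_real_diff)
    have "1 - z = complex_of_real (exp (- t))" by (simp add: z_def)
    then have Ln: "Ln (1 - z) = - complex_of_real t"
      by (simp only: Ln_of_real exp_gt_zero ln_exp) simp
    have "exp (\<i> * Ln (1 - z)) = cis (- t)"
      by (simp add: Ln cis_conv_exp)
    also have "\<dots> = 1"
      unfolding t_def using cis_multiple_2pi[of "- real n"] by simp
    finally have osc: "exp (\<i> * Ln (1 - z)) = 1" .
    have "spiral_factor z = \<i>" by (simp add: spiral_factor_def osc)
    moreover have "norm (exp (- growth_rate * Ln (1 - z))) = exp (growth_rate * t)"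
      by (simp add: Ln)
    moreover have "norm (1 - z) = exp (- t)" by (simp add: z_def)
    ultimately have "norm (spiral_deriv z) = exp (growth_rate * t) / exp (- t)"
      by (simp add: spiral_deriv_def norm_mult norm_divide)
    moreover have "spiral z = 0" by (simp add: spiral_def osc)
    moreover have "\<not> is_pole spiral z"
      using spiral_analytic z analytic_at_imp_no_pole analytic_on_analytic_at by blast
    ultimately have sph: "spherical_deriv spiral z = exp (growth_rate * t) / exp (- t)"
      by (simp add: spherical_deriv_def deriv_spiral[OF z])
    have "norm z = 1 - exp (- t)"
      using exp_t by (simp add: z_def del: of_real_diff)
    then have "1 - (norm z)\<^sup>2 = exp (- t) * (2 - exp (- t))"
      by (simp only:) (simp add: power2_eq_square algebra_simps)
    also have "\<dots> \<ge> exp (- t) * 1"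
      using exp_t by (intro mult_left_mono) auto
    finally have "exp (- t) * (exp (growth_rate * t) / exp (- t)) \<le> (1 - (norm z)\<^sup>2) * spherical_deriv spiral z"
      unfolding sph by (intro mult_right_mono) auto
    with M[OF z] show ?thesis by (simp add: t_def)
  qed
  define c where "c = growth_rate * (2 * pi)"
  have "c > 0" using growth_rate_pos by (simp add: c_def)
  obtain n where n: "M < real n * c"
    using reals_Archimedean3[OF \<open>c > 0\<close>] by auto
  \<comment> \<open>The Archimedean n may be 0, whereas \<open>unbounded\<close> asks for a positive
    index.\<close>
  with \<open>c > 0\<close> have "M < real (Suc n) * c"
    by (simp add: algebra_simps)
  also have "\<dots> \<le> exp (real (Suc n) * c)"
    using exp_ge_add_one_self[of "real (Suc n) * c"] by linarith
  also have "real (Suc n) * c = growth_rate * (2 * pi * real (Suc n))"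
    by (simp only: c_def mult_ac)
  also have "exp (growth_rate * (2 * pi * real (Suc n))) \<le> M"
    by (rule unbounded) simp
  finally show False by simp
qed

section \<open>Integrals of powers of the distance to a point\<close>

lemma powr_antimono_base:
  fixes x y a :: real
  assumes "0 < x" "x \<le> y" "a \<le> 0"
  shows "y powr a \<le> x powr a"
  using assms powr_mono2[of "- a" x y]
  by (simp add: powr_minus divide_simps)

text \<open>The bound is uniform in the position c: the part of the interval inside [-L, L]
  contributes at most 2 L^q / q, and outside it the integrand is at most L^(q - 1), on a set of
  length at most L.\<close>

lemma nn_integral_abs_powr_interval_le:
  fixes c L q :: real
  assumes q: "0 < q" "q \<le> 1" and L: "L > 0"
  shows "(\<integral>\<^sup>+x. ennreal (\<bar>x\<bar> powr (q - 1)) * indicator {c..c + L} x \<partial>lborel)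
           \<le> ennreal ((2 / q + 1) * L powr q)"
proof -
  let ?g = "\<lambda>x::real. ennreal (\<bar>x\<bar> powr (q - 1))"
  have "((\<lambda>x. x powr (q - 1)) has_integral (L powr q / q)) {0..L}"
    using has_integral_powr_from_0[of "q - 1" L] q L by simp
  then have "((\<lambda>x. \<bar>x\<bar> powr (q - 1)) has_integral (L powr q / q)) {0..L}"
    by (rule has_integral_eq[rotated]) simp
  then have pos: "(\<integral>\<^sup>+x. ?g x * indicator {0..L} x \<partial>lborel) = ennreal (L powr q / q)"
    by (intro nn_integral_has_integral_lebesgue') auto
  have neg: "(\<integral>\<^sup>+x. ?g x * indicator {- L..0} x \<partial>lborel) = ennreal (L powr q / q)"
  proof -
    have "(\<integral>\<^sup>+x. ?g x * indicator {- L..0} x \<partial>lborel)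
        = (\<integral>\<^sup>+x. ?g (0 + - 1 * x) * indicator {- L..0} (0 + - 1 * x) \<partial>lborel)"
      by (subst nn_integral_real_affine[where c = "- 1" and t = 0]) auto
    also have "\<dots> = (\<integral>\<^sup>+x. ?g x * indicator {0..L} x \<partial>lborel)"
      by (intro nn_integral_cong) (auto simp: indicator_def)
    finally show ?thesis using pos by simp
  qed
  have far: "(\<integral>\<^sup>+x. ennreal (L powr (q - 1)) * indicator {c..c + L} x \<partial>lborel) = ennreal (L powr q)"
    using L by (simp add: nn_integral_cmult flip: ennreal_mult powr_mult_base)
      (simp add: powr_diff)
  have "(\<integral>\<^sup>+x. ?g x * indicator {c..c + L} x \<partial>lborel)
      \<le> (\<integral>\<^sup>+x. (?g x * indicator {0..L} x + ?g x * indicator {- L..0} x)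
            + ennreal (L powr (q - 1)) * indicator {c..c + L} x \<partial>lborel)"
  proof (intro nn_integral_mono)
    fix x :: real
    show "?g x * indicator {c..c + L} x
      \<le> (?g x * indicator {0..L} x + ?g x * indicator {- L..0} x)
            + ennreal (L powr (q - 1)) * indicator {c..c + L} x"
    proof (cases "\<bar>x\<bar> \<le> L")
      case True
      then have "x \<in> {0..L} \<or> x \<in> {- L..0}" by auto
      then show ?thesis
        by (auto simp: indicator_def add_increasing add_increasing2)
    next
      case False
      then have "\<bar>x\<bar> powr (q - 1) \<le> L powr (q - 1)"
        using q L by (intro powr_antimono_base) auto
      with False show ?thesis
        by (auto simp: indicator_def ennreal_leI)
    qed
  qed
  also have "\<dots> = ennreal (L powr q / q) + ennreal (L powr q / q) + ennreal (L powr q)"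
    using pos neg far by (simp add: nn_integral_add)
  also have "\<dots> = ennreal ((2 / q + 1) * L powr q)"
    using q by (simp add: algebra_simps flip: ennreal_plus)
  finally show ?thesis .
qed

text \<open>
  The bound by a product of functions of the coordinates replaces polar coordinates. It fails on
  the axes, where \<open>0 powr (p / 2 - 1) = 0\<close>.
\<close>

lemma norm_powr_le_prod_powr:
  fixes z :: complex and p :: real
  assumes "p \<le> 2" "Re z \<noteq> 0" "Im z \<noteq> 0"
  shows "norm z powr (p - 2) \<le> \<bar>Re z\<bar> powr (p / 2 - 1) * \<bar>Im z\<bar> powr (p / 2 - 1)"
proof -
  have "\<bar>Re z\<bar> * \<bar>Im z\<bar> \<le> norm z * norm z"
    by (intro mult_mono abs_Re_le_cmod abs_Im_le_cmod) auto
  with assms have "(norm z * norm z) powr (p / 2 - 1) \<le> (\<bar>Re z\<bar> * \<bar>Im z\<bar>) powr (p / 2 - 1)"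
    by (intro powr_antimono_base) auto
  then show ?thesis
    by (simp add: powr_mult flip: powr_add)
qed

text \<open>The product bound and Tonelli reduce this to two one-dimensional integrals with exponent
  p / 2 - 1, each at most (4 / p + 1) L^(p / 2). Neither w nor the corner c affects the
  constant.\<close>

lemma nn_integral_norm_powr_square_le:
  fixes c w :: complex and p L :: real
  assumes p: "0 < p" "p \<le> 2" and L: "L > 0"
  shows "(\<integral>\<^sup>+z. ennreal (norm (z - w) powr (p - 2))
            * indicator {z. Re z \<in> {Re c..Re c + L} \<and> Im z \<in> {Im c..Im c + L}} z \<partial>lborel)
           \<le> ennreal ((4 / p + 1)\<^sup>2 * L powr p)"
proof -
  define q where "q = p / 2"
  have q: "0 < q" "q \<le> 1" using p by (simp_all add: q_def)
  \<comment> \<open>Coordinates are written as inner products with basis vectors to fit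
    \<open>nn_integral_lborel_prod\<close>.\<close>
  define f where "f b x = ennreal (\<bar>x - w \<bullet> b\<bar> powr (q - 1)) * indicator {c \<bullet> b..c \<bullet> b + L} x"
    for b :: complex and x :: real
  have [measurable]: "f b \<in> borel_measurable borel" for b
    unfolding f_def [abs_def] by measurable
  \<comment> \<open>The product bound may fail on the two coordinate lines through w; these are null
    sets, so an almost-everywhere inequality suffices.\<close>
  have null: "AE z in lborel. (z::complex) \<bullet> b \<noteq> w \<bullet> b" if "b \<in> Basis" for b
  proof -
    have "{z. z \<bullet> b = w \<bullet> b} \<in> null_sets (lborel :: complex measure)"
      using that negligible_standard_hyperplane[of b "w \<bullet> b"]
      by (auto simp: negligible_iff_null_sets null_sets_completion_iff inner_commute)
    then show ?thesis by (rule AE_I') auto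
  qed
  have "AE z in lborel. Re z \<noteq> Re w" "AE z in lborel. Im z \<noteq> Im w"
    using null[of 1] null[of \<i>] by (simp_all add: Basis_complex_def)
  then have "AE z in lborel. ennreal (norm (z - w) powr (p - 2))
            * indicator {z. Re z \<in> {Re c..Re c + L} \<and> Im z \<in> {Im c..Im c + L}} z
          \<le> (\<Prod>b\<in>Basis. f b (z \<bullet> b))"
  proof eventually_elim
    case (elim z)
    have "norm (z - w) powr (p - 2) \<le> \<bar>Re z - Re w\<bar> powr (q - 1) * \<bar>Im z - Im w\<bar> powr (q - 1)"
      using norm_powr_le_prod_powr[OF p(2), of "z - w"] elim by (simp add: q_def)
    then show ?case
      by (auto simp: f_def Basis_complex_def indicator_def ennreal_leI simp flip: ennreal_mult)
  qed
  then have "(\<integral>\<^sup>+z. ennreal (norm (z - w) powr (p - 2))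
            * indicator {z. Re z \<in> {Re c..Re c + L} \<and> Im z \<in> {Im c..Im c + L}} z \<partial>lborel)
      \<le> (\<integral>\<^sup>+z. (\<Prod>b\<in>Basis. f b (z \<bullet> b)) \<partial>lborel)"
    by (rule nn_integral_mono_AE)
  also have "\<dots> = (\<Prod>b\<in>Basis. \<integral>\<^sup>+x. f b x \<partial>lborel)"
    by (rule nn_integral_lborel_prod) auto
  also have "\<dots> \<le> (\<Prod>b\<in>(Basis :: complex set). ennreal ((2 / q + 1) * L powr q))"
  proof (rule prod_mono_ennreal)
    fix b :: complex
    let ?c = "c \<bullet> b - w \<bullet> b"
    have "(\<integral>\<^sup>+x. f b x \<partial>lborel) = (\<integral>\<^sup>+x. f b (w \<bullet> b + 1 * x) \<partial>lborel)"
      by (subst nn_integral_real_affine[where c = 1 and t = "w \<bullet> b"]) auto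
    also have "\<dots> = (\<integral>\<^sup>+x. ennreal (\<bar>x\<bar> powr (q - 1)) * indicator {?c..?c + L} x \<partial>lborel)"
      by (intro nn_integral_cong) (auto simp: f_def indicator_def)
    also have "\<dots> \<le> ennreal ((2 / q + 1) * L powr q)"
      by (rule nn_integral_abs_powr_interval_le[OF q L])
    finally show "(\<integral>\<^sup>+x. f b x \<partial>lborel) \<le> ennreal ((2 / q + 1) * L powr q)" .
  qed
  also have "\<dots> = ennreal (((2 / q + 1) * L powr q) * ((2 / q + 1) * L powr q))"
    using q by (subst ennreal_mult) (simp_all add: Basis_complex_def)
  also have "((2 / q + 1) * L powr q) * ((2 / q + 1) * L powr q) = (4 / p + 1)\<^sup>2 * L powr (q + q)"
    unfolding powr_add by (simp add: q_def power2_eq_square)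
  also have "q + q = p" by (simp add: q_def)
  finally show ?thesis .
qed

section \<open>Carleson squares\<close>

text \<open>The chord has length 2 |sin ((s - t) / 2)|.\<close>

lemma norm_cis_diff_le: "norm (cis s - cis t) \<le> \<bar>s - t\<bar>"
proof -
  have "(norm (cis s - cis t))\<^sup>2 = (cos s - cos t)\<^sup>2 + (sin s - sin t)\<^sup>2"
    by (simp add: cmod_power2)
  also have "\<dots> = ((cos s)\<^sup>2 + (sin s)\<^sup>2) + ((cos t)\<^sup>2 + (sin t)\<^sup>2) - 2 * cos (s - t)"
    by (simp add: cos_diff power2_eq_square algebra_simps)
  also have "cos (s - t) = cos (2 * ((s - t) / 2))"
    by (rule arg_cong[where f = cos]) simp
  also have "(cos s)\<^sup>2 + (sin s)\<^sup>2 + ((cos t)\<^sup>2 + (sin t)\<^sup>2) - 2 * cos (2 * ((s - t) / 2))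
      = 4 * (sin ((s - t) / 2))\<^sup>2"
    unfolding cos_double_sin by simp
  also have "\<dots> \<le> 4 * ((s - t) / 2)\<^sup>2"
    using abs_sin_x_le_abs_x[of "(s - t) / 2"]
    by (intro mult_left_mono abs_le_square_iff[THEN iffD1]) auto
  also have "\<dots> = \<bar>s - t\<bar>\<^sup>2"
    by (simp add: power2_eq_square)
  finally show ?thesis
    by (rule power2_le_imp_le) simp
qed

section \<open>Arcs and their normalized length\<close>

lemma cis_eq_iff: "cis s = cis t \<longleftrightarrow> (\<exists>n::int. s = t + 2 * pi * n)"
  using sin_cos_eq_iff[of s t] by (auto simp: complex_eq_iff)

text \<open>By periodicity the preimage is the union of the translates of the interval by multiples
  of 2 pi.\<close>

lemma open_cis_vimage_open_arc: "open (cis -` cis ` {a<..<b})"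
proof -
  have "cis -` cis ` {a<..<b} = (\<Union>n::int. {a + 2 * pi * n<..<b + 2 * pi * n})"
  proof (intro set_eqI iffI)
    fix t assume "t \<in> cis -` cis ` {a<..<b}"
    then obtain s and n :: int where "s \<in> {a<..<b}" "t = s + 2 * pi * n"
      by (auto simp: cis_eq_iff)
    then show "t \<in> (\<Union>n::int. {a + 2 * pi * n<..<b + 2 * pi * n})"
      by (auto intro!: exI[of _ n])
  next
    fix t assume "t \<in> (\<Union>n::int. {a + 2 * pi * n<..<b + 2 * pi * n})"
    then obtain n :: int where "t - 2 * pi * n \<in> {a<..<b}"
      by (auto simp: algebra_simps)
    moreover have "cis t = cis (t - 2 * pi * n)"
      unfolding cis_eq_iff by (auto intro!: exI[of _ n])
    ultimately show "t \<in> cis -` cis ` {a<..<b}" by auto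
  qed
  then show ?thesis by auto
qed

text \<open>An arc is its open part together with some of its two endpoints, so the preimage is an
  open set united with a closed one. This makes \<open>arc_len\<close> meaningful, as
  \<open>measure\<close> is 0 on non-measurable sets.\<close>

lemma cis_vimage_arc_measurable:
  assumes "cis ` {a<..<b} \<subseteq> I" "I \<subseteq> cis ` {a..b}"
  shows "{t \<in> {0..<2 * pi}. cis t \<in> I} \<in> sets lborel"
proof -
  have "I = cis ` {a<..<b} \<union> I \<inter> {cis a, cis b}"
  proof
    show "I \<subseteq> cis ` {a<..<b} \<union> I \<inter> {cis a, cis b}"
    proof
      fix x assume "x \<in> I"
      with assms(2) obtain t where "t \<in> {a..b}" "x = cis t" by auto
      with \<open>x \<in> I\<close> show "x \<in> cis ` {a<..<b} \<union> I \<inter> {cis a, cis b}"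
        by (cases "t = a \<or> t = b") auto
    qed
  qed (use assms(1) in auto)
  then have "{t \<in> {0..<2 * pi}. cis t \<in> I}
      = {0..<2 * pi} \<inter> (cis -` cis ` {a<..<b} \<union> cis -` (I \<inter> {cis a, cis b}))"
    by auto
  moreover have "closed (cis -` (I \<inter> {cis a, cis b}))"
    by (intro closed_vimage finite_imp_closed continuous_intros) auto
  ultimately show ?thesis
    using open_cis_vimage_open_arc[of a b] by simp
qed

text \<open>The constant 4 pi is twice the exact 2 pi: when the arc crosses the angle 0, only the
  longer of its two pieces in [0, 2 pi) is counted.\<close>

lemma arc_len_bounds:
  assumes "a < b" "b \<le> a + 2 * pi" "cis ` {a<..<b} \<subseteq> I" "I \<subseteq> cis ` {a..b}"
  shows "arc_len I \<le> 1" and "b - a \<le> 4 * pi * arc_len I"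
proof -
  let ?T = "{t \<in> {0..<2 * pi}. cis t \<in> I}"
  note T = cis_vimage_arc_measurable[OF assms(3,4)]
  have "measure lborel ?T \<le> measure lborel {0..<2 * pi}"
    using T by (intro measure_mono_fmeasurable) (auto simp: fmeasurable_def)
  then show "arc_len I \<le> 1"
    by (simp add: arc_len_def)
  \<comment> \<open>Translating by 2 pi n brings the left endpoint into [0, 2 pi).\<close>
  define n where "n = \<lfloor>a / (2 * pi)\<rfloor>"
  define a' b' where "a' = a - 2 * pi * n" and "b' = b - 2 * pi * n"
  have "of_int n \<le> a / (2 * pi)" "a / (2 * pi) < of_int n + 1"
    unfolding n_def by linarith+
  then have a': "0 \<le> a'" "a' < 2 * pi"
    by (auto simp: a'_def field_simps)
  have b': "a' < b'" "b' \<le> a' + 2 * pi" "b' - a' = b - a"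
    using assms by (auto simp: a'_def b'_def)
  have sub: "cis t \<in> I" if "t + 2 * pi * of_int m \<in> {a'<..<b'}" for t and m :: int
  proof -
    have "cis t = cis (t + 2 * pi * of_int (m + n))"
      unfolding cis_eq_iff by (auto intro!: exI[of _ "- (m + n)"] simp: algebra_simps)
    moreover have "t + 2 * pi * of_int (m + n) \<in> {a<..<b}"
      using that by (auto simp: a'_def b'_def algebra_simps)
    ultimately show ?thesis using assms(3) by auto
  qed
  \<comment> \<open>If the translated interval extends beyond 2 pi, it is cut there and the
    remainder moved back by 2 pi; the longer piece has at least half the length.\<close>
  have "\<exists>u v. u \<le> v \<and> {u<..<v} \<subseteq> ?T \<and> (b' - a') / 2 \<le> v - u"
  proof (cases "b' \<le> 2 * pi")
    case True
    have "{a'<..<b'} \<subseteq> ?T" using a' True sub[where m = 0] by auto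
    with b' show ?thesis by (intro exI[of _ a'] exI[of _ b']) auto
  next
    case False
    have "{a'<..<2 * pi} \<subseteq> ?T" using a' False sub[where m = 0] by auto
    moreover have "{0<..<b' - 2 * pi} \<subseteq> ?T" using a' b' False sub[where m = 1] by auto
    moreover have "(b' - a') / 2 \<le> 2 * pi - a' \<or> (b' - a') / 2 \<le> b' - 2 * pi - 0"
      by argo
    ultimately show ?thesis using a' False by (smt (verit))
  qed
  then obtain u v where uv: "u \<le> v" "{u<..<v} \<subseteq> ?T" "(b' - a') / 2 \<le> v - u"
    by blast
  have "?T \<in> fmeasurable lborel"
    by (rule fmeasurableI2[OF _ _ T, of "{0..<2 * pi}"]) (auto simp: fmeasurable_def)
  then have "measure lborel {u<..<v} \<le> measure lborel ?T"
    using uv by (intro measure_mono_fmeasurable) auto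
  with uv b' show "b - a \<le> 4 * pi * arc_len I"
    by (simp add: arc_len_def)
qed

text \<open>Going from z radially to the circle and then along the arc to \<open>cis a\<close> costs
  at most (1 + 4 pi) \<open>arc_len I\<close>, and pi < 4 gives the factor 17.\<close>

lemma carleson_square_subset:
  assumes "I \<subseteq> cis ` {a..b}" "arc_len I \<le> 1" "b - a \<le> 4 * pi * arc_len I"
  defines "L \<equiv> 17 * arc_len I"
  shows "carleson_square I
           \<subseteq> ball 0 1 \<inter> {z. Re z \<in> {cos a - L..cos a + L} \<and> Im z \<in> {sin a - L..sin a + L}}"
proof
  fix z assume "z \<in> carleson_square I"
  then obtain r \<theta> where z: "z = of_real r * cis \<theta>" "1 - arc_len I \<le> r" "r < 1" "cis \<theta> \<in> I"
    by (auto simp: carleson_square_def)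
  then obtain t where t: "t \<in> {a..b}" "cis \<theta> = cis t" using assms(1) by auto
  have "norm (z - cis t) = norm (of_real (r - 1) * cis t)"
    by (simp add: z t algebra_simps)
  also have "\<dots> = 1 - r"
    using z by (simp only: norm_mult norm_cis norm_of_real) simp
  finally have "norm (z - cis a) \<le> (1 - r) + \<bar>t - a\<bar>"
    using norm_triangle_ineq[of "z - cis t" "cis t - cis a"] norm_cis_diff_le[of t a] by simp
  also have "\<dots> \<le> arc_len I + 4 * pi * arc_len I"
    using z t assms by auto
  also have "\<dots> \<le> L"
  proof -
    have "0 \<le> arc_len I" using z by (simp add: arc_len_def)
    then show ?thesis
      using mult_right_mono[of pi 4 "arc_len I"] pi_less_4 by (simp add: L_def)
  qed
  finally have d: "norm (z - cis a) \<le> L" .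
  then have "\<bar>Re z - cos a\<bar> \<le> L" "\<bar>Im z - sin a\<bar> \<le> L"
    using abs_Re_le_cmod[of "z - cis a"] abs_Im_le_cmod[of "z - cis a"] by simp_all
  \<comment> \<open>The bound \<open>arc_len I \<le> 1\<close> makes r nonnegative, so the norm is r
    itself.\<close>
  moreover have "norm z < 1"
    using z assms(2) by (simp add: norm_mult)
  ultimately show "z \<in> ball 0 1 \<inter>
      {z. Re z \<in> {cos a - L..cos a + L} \<and> Im z \<in> {sin a - L..sin a + L}}"
    by (auto simp: abs_le_iff)
qed

section \<open>From the pointwise bound to the Carleson condition\<close>

lemma carleson_density_bound:
  fixes S :: "complex \<Rightarrow> complex"
  assumes p: "0 \<le> p" and z: "z \<in> ball 0 1" and S: "norm (S z) \<le> C / (norm (1 - z))\<^sup>2"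
  shows "(norm (S z))\<^sup>2 * (1 - (norm z)\<^sup>2) powr (2 + p)
           \<le> C\<^sup>2 * 2 powr (2 + p) * norm (z - 1) powr (p - 2)"
proof -
  let ?d = "norm (z - 1)"
  have d: "?d > 0" using z by auto
  \<comment> \<open>The weight satisfies 1 - |z|^2 \<le> 2 |1 - z|. Raised to the power 2 + p and
    multiplied by |1 - z|^(-4), this leaves the exponent p - 2.\<close>
  have "1 - norm z \<le> ?d"
    using norm_triangle_ineq2[of 1 z] by (simp add: norm_minus_commute)
  moreover have "1 - (norm z)\<^sup>2 = (1 + norm z) * (1 - norm z)"
    by (simp add: power2_eq_square algebra_simps)
  ultimately have "1 - (norm z)\<^sup>2 \<le> 2 * ?d"
    using z by (auto intro!: mult_mono)
  moreover have "0 \<le> 1 - (norm z)\<^sup>2"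
    using z by (simp add: power_le_one)
  ultimately have w: "(1 - (norm z)\<^sup>2) powr (2 + p) \<le> (2 * ?d) powr (2 + p)"
    using p by (intro powr_mono2) auto
  have "(norm (S z))\<^sup>2 \<le> (C / ?d\<^sup>2)\<^sup>2"
    using S by (intro power_mono) (auto simp: norm_minus_commute)
  with w have "(norm (S z))\<^sup>2 * (1 - (norm z)\<^sup>2) powr (2 + p)
      \<le> (C / ?d\<^sup>2)\<^sup>2 * (2 * ?d) powr (2 + p)"
    by (intro mult_mono) auto
  also have "\<dots> = C\<^sup>2 * 2 powr (2 + p) * (?d powr (2 + p) / ?d powr 4)"
    using d by (simp add: powr_mult power_divide flip: power_mult)
  also have "?d powr (2 + p) / ?d powr 4 = ?d powr (p - 2)"
    using powr_diff[of ?d "2 + p" 4] by simp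
  finally show ?thesis .
qed

lemma carleson_measure_if_quadratic_pole_bound:
  fixes S :: "complex \<Rightarrow> complex"
  assumes p: "0 < p" "p \<le> 2" and S: "S analytic_on ball 0 1"
    and bound: "\<And>z. z \<in> ball 0 1 \<Longrightarrow> norm (S z) \<le> C / (norm (1 - z))\<^sup>2"
  shows "carleson_measure p
           (density (restrict_space lborel (ball 0 1))
             (\<lambda>z. ennreal ((norm (S z))\<^sup>2 * (1 - (norm z)\<^sup>2) powr (2 + p))))"
    (is "carleson_measure p (density ?M ?f)")
proof -
  define K where "K = C\<^sup>2 * 2 powr (2 + p)"
  \<comment> \<open>The enclosing square has side 2 * 17 \<open>arc_len I\<close>, hence the
    34.\<close>
  define K' where "K' = K * ((4 / p + 1)\<^sup>2 * 34 powr p)"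
  have K: "0 \<le> K" by (simp add: K_def)
  then have K': "0 \<le> K'" by (simp add: K'_def)
  have "continuous_on (ball 0 1) S"
    using S by (intro holomorphic_on_imp_continuous_on analytic_imp_holomorphic)
  \<comment> \<open>Continuity of \<open>powr\<close> requires a nonzero base.\<close>
  moreover have "1 - (norm z)\<^sup>2 \<noteq> 0" if "z \<in> ball 0 1" for z :: complex
    using that abs_square_less_1[of "norm z"] by simp
  ultimately have "continuous_on (ball 0 1) (\<lambda>z. (norm (S z))\<^sup>2 * (1 - (norm z)\<^sup>2) powr (2 + p))"
    by (intro continuous_intros) auto
  then have "(\<lambda>z. (norm (S z))\<^sup>2 * (1 - (norm z)\<^sup>2) powr (2 + p))
      \<in> borel_measurable (restrict_space borel (ball 0 1))"
    by (rule borel_measurable_continuous_on_restrict)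
  also have "borel_measurable (restrict_space borel (ball 0 1)) = borel_measurable ?M"
    by (intro measurable_cong_sets sets_restrict_space_cong) auto
  finally have f: "?f \<in> borel_measurable ?M" by simp
  have "emeasure (density ?M ?f) (carleson_square I) / ennreal (arc_len I powr p) \<le> ennreal K'"
    if "I \<in> subarcs" for I
  proof -
    from that obtain a b where ab: "a < b" "b \<le> a + 2 * pi"
        "cis ` {a<..<b} \<subseteq> I" "I \<subseteq> cis ` {a..b}"
      by (auto simp: subarcs_def)
    note len = arc_len_bounds[OF ab]
    have pos: "arc_len I > 0"
      using len ab pi_gt_zero by (smt (verit) mult_nonneg_nonpos)
    define L where "L = 17 * arc_len I"
    \<comment> \<open>Lower left corner of the square R centred at \<open>cis a\<close> with
      half-side L.\<close>
    define c where "c = Complex (cos a - L) (sin a - L)"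
    define R where "R = {z. Re z \<in> {Re c..Re c + 2 * L} \<and> Im z \<in> {Im c..Im c + 2 * L}}"
    have "R = cbox c (c + Complex (2 * L) (2 * L))"
      by (auto simp: R_def cbox_def Basis_complex_def)
    then have R [measurable]: "R \<in> sets borel" by simp
    then have BR: "ball 0 1 \<inter> R \<in> sets (density ?M ?f)"
      by (auto simp: sets_restrict_space)
    have "carleson_square I \<subseteq> ball 0 1 \<inter> R"
      using carleson_square_subset[OF ab(4) len] by (simp add: R_def c_def L_def add.commute)
    \<comment> \<open>\<open>emeasure_mono\<close> asks for measurability of the larger set, here
      the part of R in the disc.\<close>
    then have "emeasure (density ?M ?f) (carleson_square I) \<le> emeasure (density ?M ?f) (ball 0 1 \<inter> R)"
      using BR by (rule emeasure_mono)
    also have "\<dots> = (\<integral>\<^sup>+z. ?f z * indicator (ball 0 1 \<inter> R) z \<partial>?M)"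
      using f BR by (intro emeasure_density) auto
    also have "\<dots> = (\<integral>\<^sup>+z. ?f z * indicator (ball 0 1 \<inter> R) z * indicator (ball 0 1) z \<partial>lborel)"
      by (rule nn_integral_restrict_space) simp
    also have "\<dots> \<le> (\<integral>\<^sup>+z. ennreal K * (ennreal (norm (z - 1) powr (p - 2)) * indicator R z) \<partial>lborel)"
    proof (rule nn_integral_mono)
      fix z :: complex
      show "?f z * indicator (ball 0 1 \<inter> R) z * indicator (ball 0 1) z
        \<le> ennreal K * (ennreal (norm (z - 1) powr (p - 2)) * indicator R z)"
      proof (cases "z \<in> ball 0 1 \<inter> R")
        case True
        then have "?f z \<le> ennreal (K * norm (z - 1) powr (p - 2))"
          unfolding K_def using p by (intro ennreal_leI carleson_density_bound bound) auto
        with True K show ?thesis by (simp add: ennreal_mult)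
      qed (auto simp: indicator_def)
    qed
    also have "\<dots> = ennreal K * (\<integral>\<^sup>+z. ennreal (norm (z - 1) powr (p - 2)) * indicator R z \<partial>lborel)"
      by (intro nn_integral_cmult) measurable
    also have "\<dots> \<le> ennreal K * ennreal ((4 / p + 1)\<^sup>2 * (2 * L) powr p)"
      unfolding R_def using p pos by (intro mult_left_mono nn_integral_norm_powr_square_le) (auto simp: L_def)
    also have "\<dots> = ennreal (K * ((4 / p + 1)\<^sup>2 * (2 * L) powr p))"
      using K by (simp add: ennreal_mult)
    also have "K * ((4 / p + 1)\<^sup>2 * (2 * L) powr p) = arc_len I powr p * K'"
      using pos by (simp add: K'_def L_def powr_mult)
    also have "ennreal (arc_len I powr p * K') = ennreal (arc_len I powr p) * ennreal K'"
      using K' by (simp add: ennreal_mult)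
    finally show ?thesis
      using pos by (intro divide_le_posI_ennreal) auto
  qed
  then have "(SUP I\<in>subarcs. emeasure (density ?M ?f) (carleson_square I) / ennreal (arc_len I powr p))
      \<le> ennreal K'"
    by (rule SUP_least)
  also have "\<dots> < \<infinity>" by simp
  finally show ?thesis
    unfolding carleson_measure_def by (simp add: sets_restrict_space_cong[of lborel borel])
qed

theorem corollary6:
  fixes p :: real
  assumes "0 < p" and "p \<le> 1"
  shows "\<exists>w :: complex \<Rightarrow> complex.
           w nicely_meromorphic_on ball 0 1 \<and>
           \<not> normal_function w \<and>
           schwarzian w analytic_on ball 0 1 \<and>
           carleson_measure p
             (density (restrict_space lborel (ball 0 1))
               (\<lambda>z. ennreal ((norm (schwarzian w z))\<^sup>2 * (1 - (norm z)\<^sup>2) powr (2 + p))))"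
proof (intro exI conjI)
  show "spiral nicely_meromorphic_on ball 0 1"
    using spiral_analytic by (rule analytic_on_imp_nicely_meromorphic_on)
  show "\<not> normal_function spiral"
    by (rule spiral_not_normal)
  show "schwarzian spiral analytic_on ball 0 1"
    by (rule schwarzian_spiral_analytic)
  then show "carleson_measure p
             (density (restrict_space lborel (ball 0 1))
               (\<lambda>z. ennreal ((norm (schwarzian spiral z))\<^sup>2 * (1 - (norm z)\<^sup>2) powr (2 + p))))"
    using assms spiral_schwarzian_bound schwarzian_spiral
    by (intro carleson_measure_if_quadratic_pole_bound[where C = 14]) auto
qed

end
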